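(* Let $k \ge 3$, let $G$ be a $k$-dicritical digraph, and let $S = \{x \in V(G) : d(x) \le 2(k-1)\}$. Then the number of connected components of $G-S$ is at most the number of connected components of $G[S]$.
   Context: Digraphs are finite, without loops and parallel arcs (digons allowed). $d(x)=d^+(x)+d^-(x)$ where $d^+(x)$, $d^-(x)$ are the numbers of out- and in-neighbours. A dicolouring colours vertices so that each colour class induces an acyclic subdigraph; $\vec{\chi}$ is the minimum number of colours; $G$ is $k$-dicritical if $\vec{\chi}(G)=k$ and every proper subdigraph has smaller dichromatic number. Connectivity is weak connectivity (of the underlying undirected graph); a connected component is a maximal vertex set inducing a connected subdigraph. Convention: the empty set is considered connected, so the empty digraph has exactly one connected component (the empty set). *)

theory Defs
  imports "Graph_Theory.Digraph_Component"
begin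

text \<open>The digraphs considered are those of the locale \<^locale>\<open>digraph\<close>: finite, without loops and without
  parallel arcs. A digon is a pair of opposite arcs and hence is allowed.\<close>

definition vertex_degree :: "('a, 'b) pre_digraph \<Rightarrow> 'a \<Rightarrow> nat" where
  "vertex_degree G x = out_degree G x + in_degree G x"

text \<open>For digraphs without parallel arcs, counting arcs is counting neighbours. A vertex joined to
  \<open>x\<close> by a digon counts twice.\<close>

lemma (in digraph) vertex_degree_neighbours:
  "vertex_degree G x = card {y. x \<rightarrow>\<^bsub>G\<^esub> y} + card {y. y \<rightarrow>\<^bsub>G\<^esub> x}"
proof -
  have "inj_on (head G) (out_arcs G x)" "inj_on (tail G) (in_arcs G x)"
    by (auto intro!: inj_onI no_multi_arcs simp: arc_to_ends_def)
  moreover have "head G ` out_arcs G x = {y. x \<rightarrow>\<^bsub>G\<^esub> y}" "tail G ` in_arcs G x = {y. y \<rightarrow>\<^bsub>G\<^esub> x}"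
    by (auto simp: arcs_ends_conv)
  ultimately show ?thesis
    unfolding vertex_degree_def out_degree_def in_degree_def by (metis card_image)
qed

text \<open>\<^const>\<open>pre_digraph.cycle\<close> is a directed cycle; both directions of a digon form a cycle of
  length two.\<close>

definition acyclic_digraph :: "('a, 'b) pre_digraph \<Rightarrow> bool" where
  "acyclic_digraph G \<longleftrightarrow> \<not> (\<exists>p. pre_digraph.cycle G p)"

definition dicolouring :: "('a, 'b) pre_digraph \<Rightarrow> nat \<Rightarrow> ('a \<Rightarrow> nat) \<Rightarrow> bool" where
  "dicolouring G k c \<longleftrightarrow>
     c ` verts G \<subseteq> {..<k} \<and> (\<forall>i<k. acyclic_digraph (G \<restriction> {v \<in> verts G. c v = i}))"

definition dichromatic_number :: "('a, 'b) pre_digraph \<Rightarrow> nat" where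
  "dichromatic_number G = (LEAST k. \<exists>c. dicolouring G k c)"

text \<open>The minimum is attained, by colouring all vertices differently.\<close>

lemma (in digraph) dichromatic_number_attained:
  "\<exists>c. dicolouring G (dichromatic_number G) c"
proof -
  obtain c :: "'a \<Rightarrow> nat" where c: "bij_betw c (verts G) {..<card (verts G)}"
    using ex_bij_betw_finite_nat[OF finite_verts] by (auto simp: atLeast0LessThan)
  have "acyclic_digraph (G \<restriction> {v \<in> verts G. c v = i})" (is "acyclic_digraph ?H") for i
    unfolding acyclic_digraph_def
  proof
    assume "\<exists>p. pre_digraph.cycle ?H p"
    then obtain u a p where "pre_digraph.awalk ?H u (a # p) u"
      unfolding pre_digraph.cycle_def by (metis neq_Nil_conv)
    then have a: "a \<in> arcs ?H"
      by (auto simp: pre_digraph.awalk_def)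
    then have "tail G a = head G a"
      using c by (auto simp: bij_betw_def dest: inj_onD)
    with a show False
      using no_loops by auto
  qed
  then have "\<exists>c. dicolouring G (card (verts G)) c"
    using c by (auto simp: dicolouring_def bij_betw_def)
  from LeastI[of "\<lambda>k. \<exists>c. dicolouring G k c", OF this] show ?thesis
    unfolding dichromatic_number_def .
qed

text \<open>A subgraph in the sense of \<^const>\<open>subgraph\<close> has the same incidence functions as \<open>G\<close>, so
  \<open>H \<noteq> G\<close> means that a vertex or an arc of \<open>G\<close> is missing in \<open>H\<close>.\<close>

definition dicritical :: "nat \<Rightarrow> ('a, 'b) pre_digraph \<Rightarrow> bool" where
  "dicritical k G \<longleftrightarrow> dichromatic_number G = k \<and>
     (\<forall>H. subgraph H G \<and> H \<noteq> G \<longrightarrow> dichromatic_number H < dichromatic_number G)"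

text \<open>\<^const>\<open>Digraph_Component.connected\<close> is connectivity of the underlying undirected graph. It
  excludes the null graph, whereas here the empty set counts as connected.\<close>

definition weakly_connected_set :: "('a, 'b) pre_digraph \<Rightarrow> 'a set \<Rightarrow> bool" where
  "weakly_connected_set G X \<longleftrightarrow> X \<subseteq> verts G \<and> (X = {} \<or> Digraph_Component.connected (G \<restriction> X))"

definition weak_components :: "('a, 'b) pre_digraph \<Rightarrow> 'a set set" where
  "weak_components G = {X. weakly_connected_set G X \<and> (\<forall>Y. weakly_connected_set G Y \<and> X \<subseteq> Y \<longrightarrow> Y = X)}"

lemma weak_components_null: "verts G = {} \<Longrightarrow> weak_components G = {{}}"
  by (auto simp: weak_components_def weakly_connected_set_def)

end

theory Submission
  imports Defs "HOL-Combinatorics.Transposition"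
begin

text \<open>Call a vertex low if it belongs to \<open>S\<close> and put \<open>n = k - 1\<close>. If a low vertex has an uncoloured
  neighbour, then one of \<open>n\<close> colours is missing among its coloured out-neighbours or among its coloured
  in-neighbours, and giving it this colour closes no monochromatic cycle. Hence a component \<open>T\<close> of
  \<open>G[S]\<close> can always be coloured greedily towards any chosen last vertex \<open>u\<close>. The last vertex causes no
  trouble if it has neighbours in two components of \<open>G - S\<close> whose colourings have been
  permuted so that two of these neighbours, \<open>x\<close> and \<open>y\<close>, get the same colour, and no monochromatic
  path joins \<open>x\<close> to \<open>y\<close>. If no vertex of \<open>T\<close> sees two components, a vertex of \<open>T\<close> whose removal
  leaves \<open>T\<close> connected is coloured and joined to the only component that it sees.

  So colouring \<open>T\<close> costs only the relative position of the colours of two components. If any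
  family of \<open>j > 0\<close> components of \<open>G[S]\<close> is attached to more than \<open>j\<close> components of \<open>G - S\<close>, these
  choices can be made independently and any colouring of \<open>G - S\<close> extends to \<open>G\<close> after permuting
  colours. If \<open>G - S\<close> has more components than \<open>G[S]\<close>, take a largest family violating this
  condition, colour it together with the components attached to it, which is possible since \<open>G\<close> is dicritical,
  and treat the result as one component: no violation remains, and \<open>G\<close> is \<open>n\<close>-dicolourable.\<close>

section \<open>Dicolourings of relations\<close>

definition adjacent :: "'a rel \<Rightarrow> 'a \<Rightarrow> 'a \<Rightarrow> bool" where
  "adjacent E v w \<longleftrightarrow> (v, w) \<in> E \<or> (w, v) \<in> E"

lemma adjacent_sym: "adjacent E v w \<longleftrightarrow> adjacent E w v"
  by (auto simp: adjacent_def)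

text \<open>Connectivity of \<open>T\<close>, phrased by cuts; the empty set satisfies it.\<close>

definition unsplit :: "'a rel \<Rightarrow> 'a set \<Rightarrow> bool" where
  "unsplit E T \<longleftrightarrow> (\<forall>C\<subseteq>T. C \<noteq> {} \<longrightarrow> C \<noteq> T \<longrightarrow> (\<exists>a\<in>C. \<exists>b\<in>T - C. adjacent E a b))"

text \<open>A path in this relation never changes colour, so its acyclicity treats all colour
  classes at once.\<close>

definition mono_arcs :: "'a rel \<Rightarrow> 'a set \<Rightarrow> ('a \<Rightarrow> nat) \<Rightarrow> 'a rel" where
  "mono_arcs E X c = {(a, b) \<in> E. a \<in> X \<and> b \<in> X \<and> c a = c b}"

definition dicolours :: "'a rel \<Rightarrow> nat \<Rightarrow> 'a set \<Rightarrow> ('a \<Rightarrow> nat) \<Rightarrow> bool" where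
  "dicolours E n X c \<longleftrightarrow> c ` X \<subseteq> {..<n} \<and> acyclic (mono_arcs E X c)"

definition total_degree :: "'a rel \<Rightarrow> 'a set \<Rightarrow> 'a \<Rightarrow> nat" where
  "total_degree E X u = card {y \<in> X. (u, y) \<in> E} + card {y \<in> X. (y, u) \<in> E}"

text \<open>The functions \<open>p\<close> and \<open>t\<close> label the vertices by the part of the coloured set \<open>P\<close>, respectively the
  component of the uncoloured set \<open>U\<close>, that contains them. Parts are merged by relabelling.\<close>

definition attached :: "'a rel \<Rightarrow> 'a set \<Rightarrow> 'a set \<Rightarrow> ('a \<Rightarrow> 'l) \<Rightarrow> ('a \<Rightarrow> 'm) \<Rightarrow> 'm set \<Rightarrow> 'l set" where
  "attached E P U p t J = {p v | v. v \<in> P \<and> (\<exists>w\<in>U. t w \<in> J \<and> adjacent E v w)}"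

lemma mono_arcs_cong:
  assumes "\<And>v. v \<in> X \<Longrightarrow> c v = c' v"
  shows "mono_arcs E X c = mono_arcs E X c'"
  using assms by (auto simp: mono_arcs_def)

lemma dicolours_cong:
  assumes "\<And>v. v \<in> X \<Longrightarrow> c v = c' v"
  shows "dicolours E n X c \<longleftrightarrow> dicolours E n X c'"
proof -
  have "c ` X = c' ` X" using assms by (auto simp: image_iff)
  then show ?thesis by (simp add: dicolours_def mono_arcs_cong[OF assms])
qed

lemma dicolours_subset:
  assumes "dicolours E n X c" "Y \<subseteq> X"
  shows "dicolours E n Y c"
proof -
  have "mono_arcs E Y c \<subseteq> mono_arcs E X c" using assms(2) by (auto simp: mono_arcs_def)
  with assms show ?thesis by (auto simp: dicolours_def intro: acyclic_subset)
qed

lemma dicolours_subrel: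
  assumes "dicolours E n X c" "F \<subseteq> E"
  shows "dicolours F n X c"
proof -
  have "mono_arcs F X c \<subseteq> mono_arcs E X c" using assms(2) by (auto simp: mono_arcs_def)
  with assms show ?thesis by (auto simp: dicolours_def intro: acyclic_subset)
qed

text \<open>No arc joins two classes of \<open>f\<close>, so a monochromatic path stays in one
  class. Colourings of the classes can thus be glued.\<close>

lemma dicolours_by_classes:
  assumes sep: "\<And>a b. a \<in> X \<Longrightarrow> b \<in> X \<Longrightarrow> (a, b) \<in> E \<Longrightarrow> f a = f b"
    and classwise: "\<And>l. dicolours E n {x \<in> X. f x = l} c"
  shows "dicolours E n X c"
proof -
  have "f a = f b \<and> (a, b) \<in> (mono_arcs E {x \<in> X. f x = f a} c)\<^sup>+"
    if "(a, b) \<in> (mono_arcs E X c)\<^sup>+" for a b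
    using that
  proof (induction rule: trancl_induct)
    case (base y)
    then have "f a = f y" "(a, y) \<in> mono_arcs E {x \<in> X. f x = f a} c"
      using sep by (auto simp: mono_arcs_def)
    then show ?case by blast
  next
    case (step y z)
    then have "f y = f z" "(y, z) \<in> mono_arcs E {x \<in> X. f x = f a} c"
      using sep by (auto simp: mono_arcs_def)
    with step.IH show ?case by (auto intro: trancl_into_trancl)
  qed
  then have "acyclic (mono_arcs E X c)"
    using classwise unfolding acyclic_def dicolours_def by blast
  moreover have "c x < n" if "x \<in> X" for x
    using classwise[of "f x"] that by (auto simp: dicolours_def)
  ultimately show ?thesis by (auto simp: dicolours_def)
qed

section \<open>Colouring one more vertex\<close>

lemma acyclic_add_vertex:
  assumes r: "acyclic r" "r \<subseteq> X \<times> X" and u: "u \<notin> X"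
    and AB: "A \<subseteq> X" "B \<subseteq> X"
    and no_path: "\<And>a b. a \<in> A \<Longrightarrow> b \<in> B \<Longrightarrow> (a, b) \<notin> r\<^sup>*"
  shows "acyclic (r \<union> {u} \<times> A \<union> B \<times> {u})"
proof -
  let ?s = "r \<union> {u} \<times> A \<union> B \<times> {u}"
  have Xr: "w \<in> X" if "(a, w) \<in> r\<^sup>*" "a \<in> X" for a w
    using that r(2) by (induction rule: rtrancl_induct) auto
  have Xl: "w \<in> X" if "(w, b) \<in> r\<^sup>*" "b \<in> X" for b w
    using that r(2) by (induction rule: converse_rtrancl_induct) auto
  \<comment> \<open>The four cases: a path avoids \<open>u\<close>, starts at \<open>u\<close>, ends
    at \<open>u\<close> or has \<open>u\<close> inside. A second visit to \<open>u\<close> is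
    forbidden by \<open>no_path\<close>.\<close>
  have main: "(z, w) \<in> r\<^sup>+ \<or> z = u \<and> (\<exists>a\<in>A. (a, w) \<in> r\<^sup>*) \<or> (\<exists>b\<in>B. (z, b) \<in> r\<^sup>*) \<and> w = u \<or>
      (\<exists>b\<in>B. (z, b) \<in> r\<^sup>*) \<and> (\<exists>a\<in>A. (a, w) \<in> r\<^sup>*)" if "(z, w) \<in> ?s\<^sup>+" for z w
    using that
  proof (induction rule: trancl_induct)
    case (base y)
    then show ?case by auto
  next
    case (step y w)
    from step.hyps(2) consider "(y, w) \<in> r" | "y = u" "w \<in> A" | "y \<in> B" "w = u" by auto
    then show ?case
    proof cases
      case 1
      then have "y \<noteq> u" using r(2) u by auto
      with step.IH 1 show ?thesis by (meson trancl_into_trancl rtrancl.rtrancl_into_rtrancl)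
    next
      case 2
      have "(z, u) \<notin> r\<^sup>+" using trancl_subset_Sigma[OF r(2)] u by auto
      moreover have "(a, u) \<notin> r\<^sup>*" if "a \<in> A" for a using Xr that AB u by auto
      ultimately have "\<exists>b\<in>B. (z, b) \<in> r\<^sup>*" using step.IH 2 by auto
      with 2 show ?thesis by auto
    next
      case 3
      then have "y \<noteq> u" using AB u by auto
      with step.IH 3 no_path have "(z, y) \<in> r\<^sup>+ \<or> (\<exists>b\<in>B. (z, b) \<in> r\<^sup>*)" by auto
      with 3 show ?thesis by (auto intro: trancl_into_rtrancl)
    qed
  qed
  show ?thesis
  proof (unfold acyclic_def, intro allI notI)
    fix z assume "(z, z) \<in> ?s\<^sup>+"
    from main[OF this] r(1) consider a where "z = u" "a \<in> A" "(a, u) \<in> r\<^sup>*"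
      | b where "z = u" "b \<in> B" "(u, b) \<in> r\<^sup>*"
      | a b where "a \<in> A" "b \<in> B" "(a, z) \<in> r\<^sup>*" "(z, b) \<in> r\<^sup>*"
      by (auto simp: acyclic_def)
    then show False
    proof cases
      case 1 then show False using Xr AB u by auto
    next
      case 2 then show False using Xl AB u by auto
    next
      case 3 then show False using no_path by (meson rtrancl_trans)
    qed
  qed
qed

text \<open>\<open>no_path\<close> is vacuous if colour \<open>i\<close> is missing among the
  out-neighbours or among the in-neighbours of \<open>u\<close> in \<open>X\<close>. The general
  form serves the last vertex of a component.\<close>

lemma dicolours_insert:
  assumes c: "dicolours E n X c" and u: "u \<notin> X" "(u, u) \<notin> E" and i: "i < n"
    and no_path: "\<And>a b. a \<in> X \<Longrightarrow> b \<in> X \<Longrightarrow> (u, a) \<in> E \<Longrightarrow> (b, u) \<in> E \<Longrightarrow> c a = i \<Longrightarrow> c b = i \<Longrightarrow>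
      (a, b) \<notin> (mono_arcs E X c)\<^sup>*"
  shows "dicolours E n (insert u X) (c(u := i))"
proof -
  let ?A = "{a \<in> X. (u, a) \<in> E \<and> c a = i}" and ?B = "{b \<in> X. (b, u) \<in> E \<and> c b = i}"
  have "mono_arcs E (insert u X) (c(u := i)) = mono_arcs E X c \<union> {u} \<times> ?A \<union> ?B \<times> {u}"
    using u by (auto simp: mono_arcs_def split: if_splits)
  moreover have "acyclic (mono_arcs E X c \<union> {u} \<times> ?A \<union> ?B \<times> {u})"
    using c u no_path by (intro acyclic_add_vertex[where X = X]) (auto simp: dicolours_def mono_arcs_def)
  ultimately show ?thesis using c i u by (auto simp: dicolours_def)
qed

lemma missing_colour:
  assumes "finite Y" "card Y < n"
  obtains i where "i < n" "i \<notin> c ` Y"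
proof -
  have "card (c ` Y) < card {..<n}" using assms card_image_le[of Y c] by simp
  then have "\<not> {..<n} \<subseteq> c ` Y" using assms(1) by (meson card_mono finite_imageI not_le)
  then show ?thesis using that by auto
qed

text \<open>If the out-degree and the in-degree into \<open>X\<close> sum to less than
  \<open>2 * n\<close>, one of them is less than \<open>n\<close>, and the \<open>n\<close> colours
  cannot all occur on that side.\<close>

lemma dicolours_insert_low:
  assumes c: "dicolours E n X c" and X: "finite X" and u: "u \<notin> X" "(u, u) \<notin> E"
    and low: "total_degree E X u < 2 * n"
  obtains i where "dicolours E n (insert u X) (c(u := i))"
proof -
  consider "card {y \<in> X. (u, y) \<in> E} < n" | "card {y \<in> X. (y, u) \<in> E} < n"
    using low by (force simp: total_degree_def)
  then show ?thesis
  proof cases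
    case 1
    then obtain i where "i < n" "i \<notin> c ` {y \<in> X. (u, y) \<in> E}"
      using missing_colour[of "{y \<in> X. (u, y) \<in> E}" n c] X by auto
    then show ?thesis using c u by (intro that dicolours_insert) auto
  next
    case 2
    then obtain i where "i < n" "i \<notin> c ` {y \<in> X. (y, u) \<in> E}"
      using missing_colour[of "{y \<in> X. (y, u) \<in> E}" n c] X by auto
    then show ?thesis using c u by (intro that dicolours_insert) (auto simp: image_iff)
  qed
qed

section \<open>Greedy colouring of connected sets\<close>

lemma total_degree_mono:
  assumes "finite Y" "X \<subseteq> Y"
  shows "total_degree E X u \<le> total_degree E Y u"
  unfolding total_degree_def using assms by (intro add_mono card_mono) auto

lemma total_degree_less:
  assumes "finite Y" "X \<subseteq> Y" "z \<in> Y - X" "adjacent E u z"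
  shows "total_degree E X u < total_degree E Y u"
proof -
  have sub: "{y \<in> X. (u, y) \<in> E} \<subseteq> {y \<in> Y. (u, y) \<in> E}" "{y \<in> X. (y, u) \<in> E} \<subseteq> {y \<in> Y. (y, u) \<in> E}"
    using assms by auto
  have fin: "finite {y \<in> Y. (u, y) \<in> E}" "finite {y \<in> Y. (y, u) \<in> E}" using assms by auto
  from assms(4) consider "(u, z) \<in> E" | "(z, u) \<in> E" by (auto simp: adjacent_def)
  then show ?thesis
  proof cases
    case 1
    then have "{y \<in> X. (u, y) \<in> E} \<subset> {y \<in> Y. (u, y) \<in> E}" using assms by auto
    from psubset_card_mono[OF fin(1) this] card_mono[OF fin(2) sub(2)]
    show ?thesis by (simp add: total_degree_def)
  next
    case 2
    then have "{y \<in> X. (y, u) \<in> E} \<subset> {y \<in> Y. (y, u) \<in> E}" using assms by auto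
    from psubset_card_mono[OF fin(2) this] card_mono[OF fin(1) sub(1)]
    show ?thesis by (simp add: total_degree_def)
  qed
qed

text \<open>A largest connected proper subset \<open>C\<close> containing \<open>u\<close> has an
  outer neighbour \<open>w\<close>. Adding \<open>w\<close> keeps it connected, so by maximality
  only \<open>w\<close> was missing.\<close>

lemma unsplit_remove_vertex:
  assumes T: "finite T" "unsplit E T" "u \<in> T" "T \<noteq> {u}"
  obtains w z where "w \<in> T" "w \<noteq> u" "unsplit E (T - {w})" "z \<in> T - {w}" "adjacent E w z"
proof -
  let ?Q = "\<lambda>C. u \<in> C \<and> C \<subset> T \<and> unsplit E C"
  have "?Q {u}" using T by (auto simp: unsplit_def)
  moreover have "\<forall>C. ?Q C \<longrightarrow> card C < card T" using T(1) by (auto intro: psubset_card_mono)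
  ultimately obtain C where C: "?Q C" and max: "\<And>D. ?Q D \<Longrightarrow> card D \<le> card C"
    using ex_has_greatest_nat[of ?Q "{u}" card "card T"] by (metis (no_types, lifting))
  from C T(2) obtain z w where zw: "z \<in> C" "w \<in> T - C" "adjacent E z w"
    unfolding unsplit_def by (metis empty_iff psubset_imp_subset psubset_eq)
  have "unsplit E (insert w C)"
    unfolding unsplit_def
  proof (intro allI impI)
    fix D assume D: "D \<subseteq> insert w C" "D \<noteq> {}" "D \<noteq> insert w C"
    show "\<exists>a\<in>D. \<exists>b\<in>insert w C - D. adjacent E a b"
    proof (cases "D \<inter> C = {} \<or> D \<inter> C = C")
      case True
      then consider "D \<inter> C = {}" | "C \<subseteq> D" by auto
      then show ?thesis
      proof cases
        case 1
        then have "D = {w}" using D by auto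
        then show ?thesis using zw by (auto simp: adjacent_sym[of E w])
      next
        case 2
        then have "D = C" using D by auto
        then show ?thesis using zw by auto
      qed
    next
      case False
      then obtain a b where "a \<in> D \<inter> C" "b \<in> C - D \<inter> C" "adjacent E a b"
        using C unfolding unsplit_def by (metis inf_le2)
      then show ?thesis by auto
    qed
  qed
  moreover have "card C < card (insert w C)"
    using zw C T(1) by (metis DiffD2 card_insert_disjoint finite_subset lessI psubset_imp_subset)
  ultimately have "insert w C = T" using C zw max[of "insert w C"] by auto
  then have "C = T - {w}" using zw by auto
  with C zw show ?thesis by (intro that[of w z]) (auto simp: adjacent_sym[of E w])
qed

text \<open>The vertices are coloured in an order that keeps the uncoloured rest connected and
  leaves \<open>u\<close> to the end, where no uncoloured neighbour in \<open>T\<close> remains to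
  help.\<close>

lemma dicolours_extend_except:
  assumes "finite Z" "finite T" "unsplit E T" "u \<in> T" "Z \<inter> T = {}" "dicolours E n Z c"
    and "\<And>w. w \<in> T \<Longrightarrow> (w, w) \<notin> E \<and> total_degree E (Z \<union> T) w \<le> 2 * n"
  shows "\<exists>c'. dicolours E n (Z \<union> (T - {u})) c' \<and> (\<forall>v\<in>Z. c' v = c v)"
  using assms
proof (induction "card T" arbitrary: T Z c)
  case 0
  then show ?case by auto
next
  case (Suc m)
  show ?case
  proof (cases "T = {u}")
    case True
    with Suc.prems show ?thesis by auto
  next
    case False
    then obtain w z where w: "w \<in> T" "w \<noteq> u" "unsplit E (T - {w})" "z \<in> T - {w}" "adjacent E w z"
      using unsplit_remove_vertex Suc.prems by metis
    \<comment> \<open>The neighbour \<open>z\<close> is still uncoloured, which makes the degree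
      into \<open>Z\<close> strictly smaller than \<open>2 * n\<close>.\<close>
    have "total_degree E Z w < total_degree E (Z \<union> T) w"
      using w Suc.prems by (intro total_degree_less[of _ _ z]) auto
    also have "\<dots> \<le> 2 * n" using Suc.prems w by auto
    finally obtain i where i: "dicolours E n (insert w Z) (c(w := i))"
      using dicolours_insert_low[of E n Z c w] Suc.prems w by blast
    have U: "insert w (Z \<union> (T - {w})) = Z \<union> T" using w by auto
    have "\<exists>c'. dicolours E n (insert w Z \<union> (T - {w} - {u})) c' \<and> (\<forall>v\<in>insert w Z. c' v = (c(w := i)) v)"
      using Suc w i by (intro Suc.hyps(1)) (auto simp: U simp del: fun_upd_apply)
    moreover have "insert w Z \<union> (T - {w} - {u}) = Z \<union> (T - {u})" using w by auto
    moreover have "w \<notin> Z" using w Suc.prems by auto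
    ultimately show ?thesis by (metis fun_upd_other insertCI)
  qed
qed

section \<open>Extending dicolourings to low vertices\<close>

text \<open>By \<open>sepU\<close> and \<open>conn\<close>, each nonempty class of \<open>t\<close>
  is a single component of \<open>U\<close>. A class of \<open>p\<close> may consist of several
  components of \<open>P\<close>; this freedom permits merging.\<close>

locale low_extension =
  fixes E :: "'a rel" and n :: nat and P U :: "'a set"
    and p :: "'a \<Rightarrow> 'l" and t :: "'a \<Rightarrow> 'm" and c :: "'a \<Rightarrow> nat"
  assumes fin: "finite P" "finite U"
    and disj: "P \<inter> U = {}"
    and col: "dicolours E n P c"
    and sepP: "\<And>a b. a \<in> P \<Longrightarrow> b \<in> P \<Longrightarrow> (a, b) \<in> E \<Longrightarrow> p a = p b"
    and sepU: "\<And>a b. a \<in> U \<Longrightarrow> b \<in> U \<Longrightarrow> (a, b) \<in> E \<Longrightarrow> t a = t b"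
    and conn: "\<And>l. unsplit E {w \<in> U. t w = l}"
    and loop: "\<And>u. u \<in> U \<Longrightarrow> (u, u) \<notin> E"
    and low: "\<And>u. u \<in> U \<Longrightarrow> total_degree E (P \<union> U) u \<le> 2 * n"

text \<open>Hall's condition with surplus one. It is Lovasz's criterion for picking two attached
  parts for every component so that the picked pairs form a forest on the parts; along a forest, the
  demands on the relative position of colours never conflict.\<close>

definition expanding :: "'a rel \<Rightarrow> 'a set \<Rightarrow> 'a set \<Rightarrow> ('a \<Rightarrow> 'l) \<Rightarrow> ('a \<Rightarrow> 'm) \<Rightarrow> bool" where
  "expanding E P U p t \<longleftrightarrow> (\<forall>J\<subseteq>t ` U. J \<noteq> {} \<longrightarrow> card J < card (attached E P U p t J))"

lemma finite_attached: "finite P \<Longrightarrow> finite (attached E P U p t J)"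
  unfolding attached_def by (rule finite_subset[of _ "p ` P"]) auto

lemma attached_Un: "attached E P U p t (J \<union> J') = attached E P U p t J \<union> attached E P U p t J'"
  by (auto simp: attached_def)

lemma total_degree_cong:
  assumes "\<And>y. y \<in> X \<Longrightarrow> (u, y) \<in> E \<longleftrightarrow> (u, y) \<in> F" "\<And>y. y \<in> X \<Longrightarrow> (y, u) \<in> E \<longleftrightarrow> (y, u) \<in> F"
  shows "total_degree E X u = total_degree F X u"
proof -
  have "{y \<in> X. (u, y) \<in> E} = {y \<in> X. (u, y) \<in> F}" "{y \<in> X. (y, u) \<in> E} = {y \<in> X. (y, u) \<in> F}"
    using assms by auto
  then show ?thesis by (simp add: total_degree_def)
qed

lemma unsplit_empty: "unsplit E {}"
  by (auto simp: unsplit_def)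

section \<open>Restricting, merging and enlarging parts\<close>

context low_extension
begin

text \<open>A family \<open>J\<close> of components splits the task: inside, \<open>U1\<close> is
  coloured together with the parts \<open>P1\<close> that it touches; outside, the result is one
  coloured part with label \<open>l0\<close>.\<close>

context
  fixes J :: "'m set" and P1 U1 :: "'a set" and l0 :: 'l and c1 :: "'a \<Rightarrow> nat"
  defines "U1 \<equiv> {u \<in> U. t u \<in> J}"
    and "P1 \<equiv> {v \<in> P. p v \<in> attached E P U p t J}"
begin

lemma restrict_to_labels:
  "low_extension E n P1 U1 p t c"
proof
  show "unsplit E {w \<in> U1. t w = l}" for l
  proof (cases "l \<in> J")
    case True
    then have "{w \<in> U1. t w = l} = {w \<in> U. t w = l}" by (auto simp: U1_def)
    then show ?thesis using conn by simp
  next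
    case False
    then have "{w \<in> U1. t w = l} = {}" by (auto simp: U1_def)
    then show ?thesis by (simp only: unsplit_empty)
  qed
  show "total_degree E (P1 \<union> U1) u \<le> 2 * n" if "u \<in> U1" for u
    using low[of u] total_degree_mono[of "P \<union> U" "P1 \<union> U1" E u] that fin
    by (force simp: U1_def P1_def)
qed (use fin disj sepP sepU loop dicolours_subset[OF col, of P1] in \<open>auto simp: U1_def P1_def\<close>)

text \<open>\<open>P1\<close> contains every part that a subfamily of \<open>J\<close> touches, so
  the restriction loses no attached part.\<close>

lemma expanding_restrict_to_labels:
  assumes "expanding E P U p t"
  shows "expanding E P1 U1 p t"
  unfolding expanding_def
proof (intro allI impI)
  fix J' assume J': "J' \<subseteq> t ` U1" "J' \<noteq> {}"
  have "attached E P1 U1 p t J' = attached E P U p t J'"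
  proof
    show "attached E P1 U1 p t J' \<subseteq> attached E P U p t J'"
      unfolding attached_def P1_def U1_def by blast
    show "attached E P U p t J' \<subseteq> attached E P1 U1 p t J'"
    proof
      fix x assume "x \<in> attached E P U p t J'"
      then obtain v w where v: "x = p v" "v \<in> P" "w \<in> U" "t w \<in> J'" "adjacent E v w"
        unfolding attached_def by blast
      then have "w \<in> U1" using J'(1) by (auto simp: U1_def)
      moreover from this v have "v \<in> P1" unfolding P1_def U1_def attached_def by blast
      ultimately show "x \<in> attached E P1 U1 p t J'" using v unfolding attached_def by blast
    qed
  qed
  moreover have "J' \<subseteq> t ` U" using J'(1) by (auto simp: U1_def)
  ultimately show "card J' < card (attached E P1 U1 p t J')"
    using assms J'(2) by (simp add: expanding_def)
qed

lemma absorb_labels: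
  assumes c1: "dicolours E n (P1 \<union> U1) c1"
    and l0: "l0 \<notin> p ` P - attached E P U p t J"
  shows "low_extension E n (P \<union> U1) (U - U1) (\<lambda>v. if v \<in> P1 \<union> U1 then l0 else p v) t
    (\<lambda>v. if v \<in> P1 \<union> U1 then c1 v else c v)" (is "low_extension E n ?P ?U ?p t ?c")
proof
  \<comment> \<open>\<open>P1\<close> consists of whole parts and includes all that
    \<open>U1\<close> touches, so no arc joins the merged part to the rest of the coloured
    set.\<close>
  have no_arc: "\<not> adjacent E a b" if "a \<in> P1 \<union> U1" "b \<in> P - P1" for a b
  proof
    assume ab: "adjacent E a b"
    show False
    proof (cases "a \<in> U1")
      case True
      with that ab have "p b \<in> attached E P U p t J"
        unfolding attached_def U1_def adjacent_def by blast
      with that show False by (auto simp: P1_def)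
    next
      case False
      with that ab sepP have "p a = p b" by (auto simp: P1_def adjacent_def)
      with False that show False by (auto simp: P1_def)
    qed
  qed
  have sep: "a \<in> P1 \<union> U1 \<longleftrightarrow> b \<in> P1 \<union> U1" if "a \<in> ?P" "b \<in> ?P" "(a, b) \<in> E" for a b
    using no_arc[of a b] no_arc[of b a] that by (auto simp: adjacent_def)
  have UP: "U1 \<inter> P = {}" "P1 \<subseteq> P" using disj by (auto simp: U1_def P1_def)
  show "?p a = ?p b" if "a \<in> ?P" "b \<in> ?P" "(a, b) \<in> E" for a b
    using sep[OF that] that sepP by auto
  show "dicolours E n ?P ?c"
  proof (rule dicolours_by_classes[where f = "\<lambda>v. v \<in> P1 \<union> U1"])
    show "dicolours E n {x \<in> ?P. (x \<in> P1 \<union> U1) = l} ?c" for l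
    proof (cases l)
      case True
      then have "{x \<in> ?P. (x \<in> P1 \<union> U1) = l} = P1 \<union> U1" using UP by auto
      then show ?thesis using c1 dicolours_cong[of "P1 \<union> U1" ?c c1] by simp
    next
      case False
      then have *: "{x \<in> ?P. (x \<in> P1 \<union> U1) = l} = P - P1" using UP by auto
      have "dicolours E n (P - P1) ?c \<longleftrightarrow> dicolours E n (P - P1) c"
        using UP by (intro dicolours_cong) auto
      then show ?thesis using * dicolours_subset[OF col, of "P - P1"] by simp
    qed
  qed (use sep in auto)
  show "unsplit E {w \<in> ?U. t w = l}" for l
  proof (cases "l \<in> J")
    case True
    then have "{w \<in> ?U. t w = l} = {}" by (auto simp: U1_def)
    then show ?thesis by (simp only: unsplit_empty)
  next
    case False
    then have "{w \<in> ?U. t w = l} = {w \<in> U. t w = l}" by (auto simp: U1_def)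
    then show ?thesis using conn by simp
  qed
  have "?P \<union> ?U = P \<union> U" by (auto simp: U1_def)
  then show "total_degree E (?P \<union> ?U) u \<le> 2 * n" if "u \<in> ?U" for u
    using low that by simp
qed (use fin disj sepU loop in \<open>auto simp: U1_def\<close>)

text \<open>The parts attached to \<open>J\<close> collapse into the single label \<open>l0\<close>,
  while all other parts keep their labels.\<close>

lemma attached_absorb_labels:
  fixes J' :: "'m set"
  defines "N \<equiv> attached E (P \<union> U1) (U - U1) (\<lambda>v. if v \<in> P1 \<union> U1 then l0 else p v) t J'"
  assumes J': "J' \<subseteq> t ` (U - U1)"
  shows "attached E P U p t J' - attached E P U p t J \<subseteq> N"
    and "attached E P U p t J' \<inter> attached E P U p t J \<noteq> {} \<Longrightarrow> l0 \<in> N"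
proof -
  have key: "(if p v \<in> attached E P U p t J then l0 else p v) \<in> N"
    if v: "v \<in> P" "w \<in> U" "t w \<in> J'" "adjacent E v w" for v w
  proof -
    have "w \<in> U - U1" using J' v by (auto simp: U1_def)
    moreover have "v \<notin> U1" using v disj by (auto simp: U1_def)
    ultimately have "(if v \<in> P1 \<union> U1 then l0 else p v) \<in> N"
      using v unfolding N_def attached_def by blast
    then show ?thesis using v(1) \<open>v \<notin> U1\<close> by (simp add: P1_def)
  qed
  have key': "(if x \<in> attached E P U p t J then l0 else x) \<in> N"
    if "x \<in> attached E P U p t J'" for x
  proof -
    from that obtain v w where v: "x = p v" "v \<in> P" "w \<in> U" "t w \<in> J'" "adjacent E v w"
      unfolding attached_def by blast
    from key[OF v(2-5)] v(1) show ?thesis by (simp only:)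
  qed
  show "attached E P U p t J' - attached E P U p t J \<subseteq> N"
  proof
    fix x assume "x \<in> attached E P U p t J' - attached E P U p t J"
    with key'[of x] show "x \<in> N" by simp
  qed
  assume "attached E P U p t J' \<inter> attached E P U p t J \<noteq> {}"
  then obtain x where "x \<in> attached E P U p t J'" "x \<in> attached E P U p t J" by blast
  with key'[of x] show "l0 \<in> N" by simp
qed

end

text \<open>The uncoloured neighbour \<open>w\<close> guarantees a colour for \<open>u\<close>. As
  \<open>u\<close> sees no other part, it can join the part \<open>l\<close>; if it sees none at
  all, any \<open>l\<close> will do.\<close>

lemma absorb_vertex:
  assumes u: "u \<in> U" "w \<in> U" "u \<noteq> w" "adjacent E u w"
    and uns: "unsplit E ({w \<in> U. t w = t u} - {u})"
    and one: "\<And>v. v \<in> P \<Longrightarrow> adjacent E v u \<Longrightarrow> p v = l"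
  obtains i where "low_extension E n (insert u P) (U - {u}) (p(u := l)) t (c(u := i))"
proof -
  have uP: "u \<notin> P" using u disj by auto
  have "total_degree E P u < total_degree E (P \<union> U) u"
    using u disj fin by (intro total_degree_less[of _ _ w]) auto
  also have "\<dots> \<le> 2 * n" using low u by simp
  finally obtain i where i: "dicolours E n (insert u P) (c(u := i))"
    using dicolours_insert_low[OF col fin(1) uP loop[OF u(1)]] by blast
  have PU: "insert u P \<union> (U - {u}) = P \<union> U" using u by auto
  have "low_extension E n (insert u P) (U - {u}) (p(u := l)) t (c(u := i))"
  proof
    show "unsplit E {w \<in> U - {u}. t w = l'}" for l'
    proof (cases "l' = t u")
      case True
      then have "{w \<in> U - {u}. t w = l'} = {w \<in> U. t w = t u} - {u}" by auto
      then show ?thesis using uns by simp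
    next
      case False
      then have "{w \<in> U - {u}. t w = l'} = {w \<in> U. t w = l'}" by auto
      then show ?thesis using conn by simp
    qed
    show "(p(u := l)) a = (p(u := l)) b" if "a \<in> insert u P" "b \<in> insert u P" "(a, b) \<in> E" for a b
      using that one[of a] one[of b] sepP[OF _ _ that(3)] loop[OF u(1)] uP by (auto simp: adjacent_def)
    show "total_degree E (insert u P \<union> (U - {u})) x \<le> 2 * n" if "x \<in> U - {u}" for x
      using low that unfolding PU by simp
    show "dicolours E n (insert u P) (c(u := i))" by (rule i)
    show "t a = t b" if "a \<in> U - {u}" "b \<in> U - {u}" "(a, b) \<in> E" for a b
      using that sepU by blast
    show "(a, a) \<notin> E" if "a \<in> U - {u}" for a using that loop by blast
  qed (use fin disj in auto)
  then show ?thesis by (rule that)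
qed

lemma expanding_absorb_vertex:
  assumes ex: "expanding E P U p t"
    and u: "u \<in> U" "w \<in> U" "u \<noteq> w" "adjacent E u w"
    and one: "\<And>v. v \<in> P \<Longrightarrow> adjacent E v u \<Longrightarrow> p v = l"
  shows "expanding E (insert u P) (U - {u}) (p(u := l)) t"
  unfolding expanding_def
proof (intro allI impI)
  fix J assume J: "J \<subseteq> t ` (U - {u})" "J \<noteq> {}"
  let ?N = "attached E (insert u P) (U - {u}) (p(u := l)) t J"
  have tuw: "t u = t w" using u sepU by (auto simp: adjacent_def)
  have uP: "u \<notin> P" using u disj by auto
  have "attached E P U p t J \<subseteq> ?N"
  proof
    fix x assume "x \<in> attached E P U p t J"
    then obtain v w' where v: "x = p v" "v \<in> P" "w' \<in> U" "t w' \<in> J" "adjacent E v w'"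
      by (auto simp: attached_def)
    show "x \<in> ?N"
    proof (cases "w' = u")
      case True
      \<comment> \<open>The part that was attached through \<open>u\<close> now contains
        \<open>u\<close>, which is adjacent to \<open>w\<close> in the same component.\<close>
      then have "x = (p(u := l)) u" "t w \<in> J" using v one tuw by auto
      with u show ?thesis unfolding attached_def by blast
    next
      case False
      then have "x = (p(u := l)) v" using v uP by auto
      with False v show ?thesis unfolding attached_def by blast
    qed
  qed
  then have "card (attached E P U p t J) \<le> card ?N"
    using fin by (intro card_mono finite_attached) auto
  moreover have "J \<subseteq> t ` U" using J by auto
  ultimately show "card J < card ?N" using ex J(2) unfolding expanding_def by (meson order_less_le_trans)
qed

text \<open>Permuting the colours of the part of \<open>y\<close> gives \<open>x\<close> and \<open>y\<close> the same colour. The new arc \<open>(y, x)\<close>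
  keeps every later dicolouring from having a monochromatic path from \<open>x\<close> to \<open>y\<close>.\<close>

lemma identify_parts:
  assumes xy: "x \<in> P" "y \<in> P" "p x \<noteq> p y"
  defines "c1 \<equiv> (\<lambda>v. if p v = p y then Transposition.transpose (c x) (c y) (c v) else c v)"
  shows "low_extension (insert (y, x) E) n P {u \<in> U. t u \<noteq> l}
    (\<lambda>v. if p v = p y then p x else p v) t c1"
proof
  let ?F = "insert (y, x) E"
  \<comment> \<open>A transposition is injective and is applied to a whole part, so it does not
    change which arcs are monochromatic.\<close>
  have same: "mono_arcs E P c1 = mono_arcs E P c"
  proof -
    have "c1 a = c1 b \<longleftrightarrow> c a = c b" if "a \<in> P" "b \<in> P" "(a, b) \<in> E" for a b
      using sepP[OF that] by (auto simp: c1_def transpose_def split: if_splits)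
    then show ?thesis by (auto simp: mono_arcs_def)
  qed
  \<comment> \<open>Monochromatic paths stay inside a part, so none runs from \<open>x\<close> to
    \<open>y\<close> and the arc \<open>(y, x)\<close> closes no cycle.\<close>
  have pres: "p b = p a" if "(a, b) \<in> (mono_arcs E P c1)\<^sup>*" for a b
    using that by (induction rule: rtrancl_induct) (auto simp: mono_arcs_def sepP)
  have "mono_arcs ?F P c1 \<subseteq> insert (y, x) (mono_arcs E P c1)"
    by (auto simp: mono_arcs_def)
  moreover have "acyclic (insert (y, x) (mono_arcs E P c1))"
    using col pres[of x y] xy by (auto simp: acyclic_insert same dicolours_def)
  ultimately have "acyclic (mono_arcs ?F P c1)" by (rule acyclic_subset[rotated])
  moreover have "c1 v < n" if "v \<in> P" for v
    using col that xy by (auto simp: c1_def dicolours_def transpose_def)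
  ultimately show "dicolours ?F n P c1" by (auto simp: dicolours_def)
  show "unsplit ?F {w \<in> {u \<in> U. t u \<noteq> l}. t w = l'}" for l'
  proof (cases "l' = l")
    case True
    then have "{w \<in> {u \<in> U. t u \<noteq> l}. t w = l'} = {}" by auto
    then show ?thesis by (simp only: unsplit_empty)
  next
    case False
    then have "{w \<in> {u \<in> U. t u \<noteq> l}. t w = l'} = {w \<in> U. t w = l'}" by auto
    moreover have "unsplit ?F {w \<in> U. t w = l'}"
      unfolding unsplit_def
    proof (intro allI impI)
      fix C assume "C \<subseteq> {w \<in> U. t w = l'}" "C \<noteq> {}" "C \<noteq> {w \<in> U. t w = l'}"
      then obtain a b where "a \<in> C" "b \<in> {w \<in> U. t w = l'} - C" "adjacent E a b"
        using conn[of l'] unfolding unsplit_def by blast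
      then show "\<exists>a\<in>C. \<exists>b\<in>{w \<in> U. t w = l'} - C. adjacent ?F a b"
        unfolding adjacent_def by blast
    qed
    ultimately show ?thesis by simp
  qed
  fix u assume u: "u \<in> {u \<in> U. t u \<noteq> l}"
  then have ne: "u \<noteq> x" "u \<noteq> y" using xy disj by auto
  then show "(u, u) \<notin> ?F" using u loop by auto
  have "total_degree ?F (P \<union> {u \<in> U. t u \<noteq> l}) u = total_degree E (P \<union> {u \<in> U. t u \<noteq> l}) u"
    using ne by (intro total_degree_cong) auto
  also have "\<dots> \<le> total_degree E (P \<union> U) u"
    using fin by (intro total_degree_mono) auto
  finally show "total_degree ?F (P \<union> {u \<in> U. t u \<noteq> l}) u \<le> 2 * n"
    using low[of u] u by simp
next
  fix a b assume "a \<in> {u \<in> U. t u \<noteq> l}" "b \<in> {u \<in> U. t u \<noteq> l}" "(a, b) \<in> insert (y, x) E"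
  then show "t a = t b" using sepU xy disj by auto
next
  fix a b assume "a \<in> P" "b \<in> P" "(a, b) \<in> insert (y, x) E"
  then show "(if p a = p y then p x else p a) = (if p b = p y then p x else p b)"
    using sepP xy by auto
qed (use fin disj in auto)

text \<open>Only the label \<open>p y\<close> is lost when the two parts are merged. Component
  \<open>l\<close> is set aside because it is coloured after the others.\<close>

lemma attached_identify_parts:
  assumes "l \<notin> J"
  shows "card (attached E P U p t J) \<le>
    Suc (card (attached (insert (y, x) E) P {u \<in> U. t u \<noteq> l} (\<lambda>v. if p v = p y then p x else p v) t J))"
proof -
  let ?N = "attached (insert (y, x) E) P {u \<in> U. t u \<noteq> l} (\<lambda>v. if p v = p y then p x else p v) t J"
  have "attached E P U p t J \<subseteq> insert (p y) ?N"
  proof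
    fix z assume "z \<in> attached E P U p t J"
    then obtain v w where v: "z = p v" "v \<in> P" "w \<in> U" "t w \<in> J" "adjacent E v w"
      by (auto simp: attached_def)
    show "z \<in> insert (p y) ?N"
    proof (cases "p v = p y")
      case False
      then have "z = (if p v = p y then p x else p v)" using v by simp
      moreover have "adjacent (insert (y, x) E) v w" "w \<in> {u \<in> U. t u \<noteq> l}"
        using v \<open>l \<notin> J\<close> by (auto simp: adjacent_def)
      ultimately show ?thesis using v unfolding attached_def by blast
    qed (use v in simp)
  qed
  then have "card (attached E P U p t J) \<le> card (insert (p y) ?N)"
    using fin by (intro card_mono) (auto intro: finite_attached)
  also have "\<dots> \<le> Suc (card ?N)" by (rule card_insert_le_m1[THEN order_trans]) auto
  finally show ?thesis .
qed

end

text \<open>If every colour occurs on both sides of \<open>u\<close>, the degree bound allows each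
  exactly once per side. Then \<open>x\<close> and \<open>y\<close> lie on opposite sides, and
  giving \<open>u\<close> their colour could close a cycle only through a path from \<open>x\<close>
  to \<open>y\<close>, which the arc \<open>(y, x)\<close> excludes.\<close>

lemma dicolours_insert_saturated:
  assumes c: "dicolours F n Z c" and Z: "finite Z" and u: "u \<notin> Z" "(u, u) \<notin> F"
    and low: "total_degree F Z u \<le> 2 * n"
    and xy: "x \<in> Z" "y \<in> Z" "x \<noteq> y" "c x = c y" "(y, x) \<in> F"
    and nbrs: "(u, x) \<in> F \<and> (u, y) \<in> F \<or> (x, u) \<in> F \<and> (y, u) \<in> F \<or> (u, x) \<in> F \<and> (y, u) \<in> F"
  shows "\<exists>i. dicolours F n (insert u Z) (c(u := i))"
proof -
  let ?O = "{v \<in> Z. (u, v) \<in> F}" and ?I = "{v \<in> Z. (v, u) \<in> F}"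
  show ?thesis
  proof (cases "{..<n} \<subseteq> c ` ?O \<and> {..<n} \<subseteq> c ` ?I")
    case False
    then obtain i where "i < n" "i \<notin> c ` ?O \<or> i \<notin> c ` ?I" by auto
    then have "dicolours F n (insert u Z) (c(u := i))"
      using c u by (intro dicolours_insert) (auto simp: image_iff)
    then show ?thesis by blast
  next
    case True
    have fin: "finite ?O" "finite ?I" using Z by auto
    have "n \<le> card (c ` ?O)" "n \<le> card (c ` ?I)"
      using True card_mono[of "c ` ?O" "{..<n}"] card_mono[of "c ` ?I" "{..<n}"] fin by auto
    moreover have "card (c ` ?O) \<le> card ?O" "card (c ` ?I) \<le> card ?I"
      using fin by (auto intro: card_image_le)
    moreover have "card ?O + card ?I \<le> 2 * n" using low by (simp add: total_degree_def)
    ultimately have "card (c ` ?O) = card ?O" "card (c ` ?I) = card ?I" by linarith+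
    then have inj: "inj_on c ?O" "inj_on c ?I" using fin by (auto intro: eq_card_imp_inj_on)
    have "\<not> ((u, x) \<in> F \<and> (u, y) \<in> F)" "\<not> ((x, u) \<in> F \<and> (y, u) \<in> F)"
      using inj_onD[OF inj(1), of x y] inj_onD[OF inj(2), of x y] xy by auto
    with nbrs have opp: "(u, x) \<in> F" "(y, u) \<in> F" by auto
    have "dicolours F n (insert u Z) (c(u := c x))"
    proof (rule dicolours_insert[OF c u])
      show "c x < n" using c xy by (auto simp: dicolours_def)
      fix a b assume ab: "a \<in> Z" "b \<in> Z" "(u, a) \<in> F" "(b, u) \<in> F" "c a = c x" "c b = c x"
      then have "a = x" "b = y" using inj_onD[OF inj(1), of a x] inj_onD[OF inj(2), of b y] xy opp by auto
      moreover have "(y, x) \<in> mono_arcs F Z c" using xy by (auto simp: mono_arcs_def)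
      ultimately show "(a, b) \<notin> (mono_arcs F Z c)\<^sup>*"
        using c unfolding dicolours_def acyclic_def by (meson rtrancl_into_trancl1)
    qed
    then show ?thesis by blast
  qed
qed

lemma expandingD:
  "expanding E P U p t \<Longrightarrow> J \<subseteq> t ` U \<Longrightarrow> J \<noteq> {} \<Longrightarrow> card J < card (attached E P U p t J)"
  by (simp add: expanding_def)

text \<open>Keeping the equality pattern of \<open>c\<close> on each part makes the induction work:
  a coincidence of colours arranged between two merged parts survives all later steps.
  \<open>E\<close> varies in the induction because arcs are added.\<close>

lemma dicolouring_extends:
  assumes "low_extension E n P U p t c" "expanding E P U p t"
  shows "\<exists>c'. dicolours E n (P \<union> U) c' \<and> (\<forall>v\<in>P. \<forall>w\<in>P. p v = p w \<longrightarrow> (c' v = c' w \<longleftrightarrow> c v = c w))"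
  using assms
proof (induction "card U" arbitrary: E P U p c rule: less_induct)
  case less
  interpret low_extension E n P U p t c by (rule less.prems)
  show ?case
  proof (cases "\<exists>J. J \<subset> t ` U \<and> J \<noteq> {} \<and> card (attached E P U p t J) = Suc (card J)")
    case True
    \<comment> \<open>A tight family is coloured first and merged with its parts, so that afterwards merging any two
      parts attached to the same component preserves the expansion of the other components.\<close>
    then obtain J where J: "J \<subset> t ` U" "J \<noteq> {}" "card (attached E P U p t J) = Suc (card J)" by blast
    define U1 where "U1 = {u \<in> U. t u \<in> J}"
    define P1 where "P1 = {v \<in> P. p v \<in> attached E P U p t J}"
    have "card U1 < card U" "card (U - U1) < card U"
      using J(1,2) fin by (auto simp: U1_def intro!: psubset_card_mono)
    note IH = less.hyps[OF this(1)] less.hyps[OF this(2)]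
    have "low_extension E n P1 U1 p t c" "expanding E P1 U1 p t"
      unfolding P1_def U1_def using restrict_to_labels expanding_restrict_to_labels less.prems(2) by blast+
    then obtain c1 where c1: "dicolours E n (P1 \<union> U1) c1"
      and c1_c: "\<And>v w. v \<in> P1 \<Longrightarrow> w \<in> P1 \<Longrightarrow> p v = p w \<Longrightarrow> c1 v = c1 w \<longleftrightarrow> c v = c w"
      using IH(1) by blast
    \<comment> \<open>The merged part takes over the label of one of the parts absorbed into
      it.\<close>
    obtain l0 where l0: "l0 \<in> attached E P U p t J" using J(3) by fastforce
    let ?p = "\<lambda>v. if v \<in> P1 \<union> U1 then l0 else p v" and ?c = "\<lambda>v. if v \<in> P1 \<union> U1 then c1 v else c v"
    have ext: "low_extension E n (P \<union> U1) (U - U1) ?p t ?c"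
      using absorb_labels[of J c1 l0] c1 l0 unfolding P1_def U1_def by blast
    have ex: "expanding E (P \<union> U1) (U - U1) ?p t"
      unfolding expanding_def
    proof (intro allI impI)
      fix J' assume J': "J' \<subseteq> t ` (U - U1)" "J' \<noteq> {}"
      let ?N = "attached E (P \<union> U1) (U - U1) ?p t J'"
      let ?A = "attached E P U p t J" and ?A' = "attached E P U p t J'"
      have N: "?A' - ?A \<subseteq> ?N" "?A' \<inter> ?A \<noteq> {} \<Longrightarrow> l0 \<in> ?N"
        using attached_absorb_labels[of J' J l0] J'(1) unfolding P1_def U1_def by blast+
      have finN: "finite ?N" "finite ?A" "finite ?A'"
        using fin by (auto intro!: finite_attached simp: U1_def)
      have J'U: "J' \<subseteq> t ` U" using J' by auto
      show "card J' < card ?N"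
      proof (cases "?A' \<inter> ?A = {}")
        case True
        then have "card ?A' \<le> card ?N" using N(1) finN by (intro card_mono) auto
        then show ?thesis using expandingD[OF less.prems(2) J'U J'(2)] by simp
      next
        case False
        have finU: "finite (t ` U)" using fin by simp
        have "finite J" "finite J'"
          using J(1) J'U finite_subset[OF _ finU] by blast+
        \<comment> \<open>Expansion of \<open>J \<union> J'\<close> together with tightness of
          \<open>J\<close> gives at least \<open>card J'\<close> parts outside \<open>?A\<close>,
          and the merged part \<open>l0\<close> supplies the missing one.\<close>
        moreover have "J \<inter> J' = {}" using J' by (auto simp: U1_def)
        ultimately have "card J + card J' < card (?A \<union> ?A')"
          using expandingD[OF less.prems(2), of "J \<union> J'"] J J'U
          by (simp add: card_Un_disjoint attached_Un)
        also have "card (?A \<union> ?A') = card ?A + card (?A' - ?A)"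
          using finN card_Un_disjoint[of ?A "?A' - ?A"] by auto
        finally have "card J' \<le> card (?A' - ?A)" using J(3) by simp
        also have "\<dots> < card (insert l0 (?A' - ?A))" using l0 finN by simp
        also have "\<dots> \<le> card ?N" using N False finN by (intro card_mono) auto
        finally show ?thesis .
      qed
    qed
    from IH(2)[OF ext ex] obtain c' where c': "dicolours E n (P \<union> U1 \<union> (U - U1)) c'"
      and c'_c: "\<And>v w. v \<in> P \<union> U1 \<Longrightarrow> w \<in> P \<union> U1 \<Longrightarrow> ?p v = ?p w \<Longrightarrow> c' v = c' w \<longleftrightarrow> ?c v = ?c w"
      by blast
    have "P \<union> U1 \<union> (U - U1) = P \<union> U" by (auto simp: U1_def)
    moreover have "c' v = c' w \<longleftrightarrow> c v = c w" if vw: "v \<in> P" "w \<in> P" "p v = p w" for v w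
    proof -
      have same: "v \<in> P1 \<union> U1 \<longleftrightarrow> v \<in> P1" "w \<in> P1 \<union> U1 \<longleftrightarrow> w \<in> P1" "v \<in> P1 \<longleftrightarrow> w \<in> P1"
        using vw disj by (auto simp: P1_def U1_def)
      then have "c' v = c' w \<longleftrightarrow> ?c v = ?c w" using vw by (intro c'_c) auto
      also have "\<dots> \<longleftrightarrow> c v = c w" using same c1_c vw by auto
      finally show ?thesis .
    qed
    ultimately show ?thesis using c' by metis
  next
    case not_tight: False
    show ?thesis
    proof (cases "U = {}")
      case True
      then show ?thesis using col by auto
    next
      case False
      then obtain u0 where u0: "u0 \<in> U" by auto
      define l where "l = t u0"
      define T where "T = {w \<in> U. t w = l}"
      have T: "finite T" "unsplit E T" "u0 \<in> T" "T \<subseteq> U" using fin conn u0 by (auto simp: T_def l_def)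
      show ?thesis
      proof (cases "\<exists>u\<in>T. \<exists>x\<in>P. \<exists>y\<in>P. p x \<noteq> p y \<and> adjacent E x u \<and> adjacent E y u")
        case True
        \<comment> \<open>Exchanging \<open>x\<close> and \<open>y\<close> covers the case where
          \<open>x\<close> is only an in-neighbour and \<open>y\<close> only an out-neighbour of
          \<open>u\<close>, so that the arc \<open>(y, x)\<close> has the right direction.\<close>
        then obtain u x y where u: "u \<in> T" and xy: "x \<in> P" "y \<in> P" "p x \<noteq> p y"
          and nbrs: "(u, x) \<in> E \<and> (u, y) \<in> E \<or> (x, u) \<in> E \<and> (y, u) \<in> E \<or> (u, x) \<in> E \<and> (y, u) \<in> E"
          unfolding adjacent_def by metis
        let ?F = "insert (y, x) E" and ?U = "{u \<in> U. t u \<noteq> l}" and ?p = "\<lambda>v. if p v = p y then p x else p v"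
        define c1 where "c1 = (\<lambda>v. if p v = p y then Transposition.transpose (c x) (c y) (c v) else c v)"
        have "card ?U < card U"
          using fin u0 by (intro psubset_card_mono) (auto simp: l_def)
        note IH = less.hyps[OF this]
        have "expanding ?F P ?U ?p t"
          unfolding expanding_def
        proof (intro allI impI)
          fix J assume J: "J \<subseteq> t ` ?U" "J \<noteq> {}"
          then have l: "l \<notin> J" by auto
          then have "J \<subset> t ` U" using J u0 by (auto simp: l_def)
          \<comment> \<open>\<open>J\<close> omits \<open>l\<close>, so it is a proper family and
            not tight. Its surplus is at least two, and merging costs at most one.\<close>
          then have "card (attached E P U p t J) \<noteq> Suc (card J)" "card J < card (attached E P U p t J)"
            using not_tight J(2) less.prems(2) by (auto simp: expanding_def)
          then show "card J < card (attached ?F P ?U ?p t J)"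
            using attached_identify_parts[OF l, of y x] by linarith
        qed
        from IH[OF identify_parts[OF xy, of l] this] obtain c2 where c2: "dicolours ?F n (P \<union> ?U) c2"
          and c2_c1: "\<And>v w. v \<in> P \<Longrightarrow> w \<in> P \<Longrightarrow> ?p v = ?p w \<Longrightarrow> c2 v = c2 w \<longleftrightarrow> c1 v = c1 w"
          unfolding c1_def by blast
        have PUT: "P \<union> ?U \<union> T = P \<union> U" by (auto simp: T_def)
        have deg: "(w, w) \<notin> ?F \<and> total_degree ?F (P \<union> U) w \<le> 2 * n" if "w \<in> T" for w
        proof -
          have "w \<noteq> x" "w \<noteq> y" using that xy T disj by auto
          then have "(w, w) \<notin> ?F" "total_degree ?F (P \<union> U) w = total_degree E (P \<union> U) w"
            using that loop T by (auto intro!: total_degree_cong)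
          then show ?thesis using low[of w] that T by auto
        qed
        have "unsplit ?F T" using T(2) unfolding unsplit_def adjacent_def by blast
        moreover have "finite (P \<union> ?U)" "(P \<union> ?U) \<inter> T = {}" using fin disj by (auto simp: T_def)
        ultimately obtain c3 where c3: "dicolours ?F n (P \<union> ?U \<union> (T - {u})) c3"
          and c3_c2: "\<And>v. v \<in> P \<union> ?U \<Longrightarrow> c3 v = c2 v"
          using dicolours_extend_except[of "P \<union> ?U" T ?F u n c2] c2 T(1) u deg
          unfolding PUT by blast
        have Z: "P \<union> ?U \<union> (T - {u}) = P \<union> U - {u}"
          using u disj by (auto simp: T_def)
        have "c1 x = c1 y" using xy by (auto simp: c1_def)
        \<comment> \<open>\<open>x\<close> and \<open>y\<close> have the same label under
          \<open>?p\<close>, so the equality of their colours under \<open>c1\<close> passes to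
          \<open>c2\<close>.\<close>
        then have "c3 x = c3 y" using c2_c1[of x y] c3_c2 xy by auto
        moreover have "total_degree ?F (P \<union> U - {u}) u \<le> 2 * n"
          using deg[OF u] total_degree_mono[of "P \<union> U" "P \<union> U - {u}" ?F u] fin by auto
        moreover have "u \<notin> P" "u \<in> U" using u T disj by auto
        ultimately obtain i where i: "dicolours ?F n (insert u (P \<union> U - {u})) (c3(u := i))"
          using dicolours_insert_saturated[of ?F n "P \<union> U - {u}" c3 u x y] c3[unfolded Z] xy nbrs fin deg[OF u]
          by auto
        have "insert u (P \<union> U - {u}) = P \<union> U" using \<open>u \<in> U\<close> by auto
        then have "dicolours E n (P \<union> U) (c3(u := i))"
          using i dicolours_subrel[of ?F n "P \<union> U" "c3(u := i)" E] by auto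
        moreover have "(c3(u := i)) v = (c3(u := i)) w \<longleftrightarrow> c v = c w"
          if vw: "v \<in> P" "w \<in> P" "p v = p w" for v w
        proof -
          have "(c3(u := i)) v = (c3(u := i)) w \<longleftrightarrow> c2 v = c2 w"
            using vw c3_c2 \<open>u \<notin> P\<close> by auto
          also have "\<dots> \<longleftrightarrow> c1 v = c1 w" using vw by (intro c2_c1) auto
          also have "\<dots> \<longleftrightarrow> c v = c w" using vw by (auto simp: c1_def transpose_def split: if_splits)
          finally show ?thesis .
        qed
        ultimately show ?thesis by blast
      next
        case one: False
        \<comment> \<open>By expansion, a component with a single vertex would have to see two parts
          through this vertex.\<close>
        have "T \<noteq> {u0}"
        proof
          assume T0: "T = {u0}"
          have "{l} \<subseteq> t ` U" using u0 by (auto simp: l_def)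
          then have "1 < card (attached E P U p t {l})"
            using expandingD[OF less.prems(2), of "{l}"] by simp
          then obtain a b where ab: "a \<in> attached E P U p t {l}" "b \<in> attached E P U p t {l}" "a \<noteq> b"
            by (metis card_le_Suc0_iff_eq finite_attached[OF fin(1)] One_nat_def not_le)
          have "\<exists>v\<in>P. z = p v \<and> adjacent E v u0" if "z \<in> attached E P U p t {l}" for z
          proof -
            from that obtain v w where v: "z = p v" "v \<in> P" "w \<in> U" "t w = l" "adjacent E v w"
              unfolding attached_def by blast
            then have "w \<in> T" by (simp add: T_def)
            with v T0 show ?thesis by auto
          qed
          then show False using one ab T(3) by metis
        qed
        then obtain w z where w: "w \<in> T" "unsplit E (T - {w})" "z \<in> T - {w}" "adjacent E w z"
          using unsplit_remove_vertex[OF T(1-3)] by metis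
        \<comment> \<open>\<open>l'\<close> is arbitrary if \<open>w\<close> sees no part.\<close>
        obtain l' where l': "\<And>v. v \<in> P \<Longrightarrow> adjacent E v w \<Longrightarrow> p v = l'"
          using one w(1) by metis
        have wz: "w \<in> U" "z \<in> U" "w \<noteq> z" using w T by auto
        have "{x \<in> U. t x = t w} = T" using w(1) by (auto simp: T_def)
        then obtain i where i: "low_extension E n (insert w P) (U - {w}) (p(w := l')) t (c(w := i))"
          using absorb_vertex[OF wz w(4) _ l'] w(2) by auto
        have ex: "expanding E (insert w P) (U - {w}) (p(w := l')) t"
          by (rule expanding_absorb_vertex[OF less.prems(2) wz w(4) l'])
        have "card (U - {w}) < card U" using fin wz by (intro psubset_card_mono) auto
        from less.hyps[OF this i ex] obtain c' where
          c': "dicolours E n (insert w P \<union> (U - {w})) c'"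
          and c'_c: "\<And>v v'. v \<in> insert w P \<Longrightarrow> v' \<in> insert w P \<Longrightarrow> (p(w := l')) v = (p(w := l')) v' \<Longrightarrow>
            c' v = c' v' \<longleftrightarrow> (c(w := i)) v = (c(w := i)) v'"
          by blast
        have "insert w P \<union> (U - {w}) = P \<union> U" using wz by auto
        moreover have "w \<notin> P" using wz disj by auto
        ultimately show ?thesis using c' c'_c by (metis fun_upd_other insertCI)
      qed
    qed
  qed
qed

section \<open>Weak components and dicritical digraphs\<close>

text \<open>In a digraph with vertices, the classes of its vertices are the weak components. They
  serve as the labels given by \<open>p\<close> and \<open>t\<close>.\<close>

definition weak_class :: "('a, 'b) pre_digraph \<Rightarrow> 'a \<Rightarrow> 'a set" where
  "weak_class H v = {w. (v, w) \<in> rtrancl_on (verts H) ((arcs_ends H)\<^sup>s)}"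

lemma sym_symcl: "sym (R\<^sup>s)"
  by (auto simp: sym_def symcl_def)

lemma symcl_iff_adjacent: "(a, b) \<in> R\<^sup>s \<longleftrightarrow> adjacent R a b"
  by (auto simp: symcl_def adjacent_def)

lemma arcs_ends_induce_subgraph:
  "arcs_ends (H \<restriction> X) = {(a, b) \<in> arcs_ends H. a \<in> X \<and> b \<in> X}"
  by (auto simp: arcs_ends_conv)

lemma weak_class_subset: "weak_class H v \<subseteq> verts H"
  by (auto simp: weak_class_def dest: in_rtrancl_on_in_F)

lemma weak_class_refl: "v \<in> verts H \<Longrightarrow> v \<in> weak_class H v"
  by (auto simp: weak_class_def)

lemma weak_class_eq:
  assumes "w \<in> weak_class H v"
  shows "weak_class H w = weak_class H v"
proof -
  have vw: "(v, w) \<in> rtrancl_on (verts H) ((arcs_ends H)\<^sup>s)" using assms by (simp add: weak_class_def)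
  then have "(w, v) \<in> rtrancl_on (verts H) ((arcs_ends H)\<^sup>s)"
    using rtrancl_on_sym[OF sym_symcl] by (meson symE)
  with vw show ?thesis unfolding weak_class_def by (auto intro: rtrancl_on_trans)
qed

lemma weak_class_arc:
  assumes "a \<in> verts H" "b \<in> verts H" "(a, b) \<in> arcs_ends H"
  shows "weak_class H a = weak_class H b"
proof -
  have "b \<in> weak_class H a"
    using assms rtrancl_on_into_rtrancl_on[of a a "verts H" "(arcs_ends H)\<^sup>s" b]
    by (auto simp: weak_class_def symcl_def)
  then show ?thesis using weak_class_eq by metis
qed

text \<open>A cut that no arc crosses would trap everything reachable from a vertex of
  \<open>C\<close>.\<close>

lemma unsplit_weak_class: "unsplit (arcs_ends H) (weak_class H v)"
  unfolding unsplit_def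
proof (intro allI impI, rule ccontr)
  fix C assume C: "C \<subseteq> weak_class H v" "C \<noteq> {}" "C \<noteq> weak_class H v"
    and no: "\<not> (\<exists>a\<in>C. \<exists>b\<in>weak_class H v - C. adjacent (arcs_ends H) a b)"
  obtain a where a: "a \<in> C" using C by auto
  then have av: "weak_class H a = weak_class H v" using C(1) weak_class_eq[of a H v] by blast
  have "w \<in> C" if "(a, w) \<in> rtrancl_on (verts H) ((arcs_ends H)\<^sup>s)" for w
    using that
  proof (induction rule: rtrancl_on_induct)
    case (step y z)
    then have "z \<in> weak_class H a" by (auto simp: weak_class_def intro: rtrancl_on_into_rtrancl_on)
    with step no av show ?case by (auto simp: symcl_iff_adjacent)
  qed (rule a)
  then have "weak_class H v \<subseteq> C" unfolding av[symmetric] by (auto simp: weak_class_def)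
  with C show False by auto
qed

lemma connected_weak_class:
  assumes "v \<in> verts H"
  shows "Digraph_Component.connected (H \<restriction> weak_class H v)"
proof -
  let ?C = "weak_class H v"
  let ?R = "rtrancl_on ?C ((arcs_ends (H \<restriction> ?C))\<^sup>s)"
  have v: "v \<in> ?C" using assms by (rule weak_class_refl)
  \<comment> \<open>Every vertex on a walk from \<open>v\<close> lies in the class, so the walk
    survives the restriction to it.\<close>
  have from_v: "(v, w) \<in> ?R" if "(v, w) \<in> rtrancl_on (verts H) ((arcs_ends H)\<^sup>s)" for w
    using that
  proof (induction rule: rtrancl_on_induct)
    case (step y z)
    then have "y \<in> ?C" "z \<in> ?C" by (auto simp: weak_class_def intro: rtrancl_on_into_rtrancl_on)
    moreover from this step have "(y, z) \<in> (arcs_ends (H \<restriction> ?C))\<^sup>s"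
      by (auto simp: symcl_iff_adjacent adjacent_def arcs_ends_induce_subgraph)
    ultimately show ?case using step by (auto intro: rtrancl_on_into_rtrancl_on)
  qed (use v in auto)
  have "(a, b) \<in> ?R" if "a \<in> ?C" "b \<in> ?C" for a b
  proof -
    have "(v, a) \<in> ?R" "(v, b) \<in> ?R" using that from_v by (auto simp: weak_class_def)
    moreover from this have "(a, v) \<in> ?R" using rtrancl_on_sym[OF sym_symcl] by (meson symE)
    ultimately show ?thesis by (blast intro: rtrancl_on_trans)
  qed
  with v show ?thesis by (auto simp: connected_conv)
qed

lemma weakly_connected_set_subset_weak_class:
  assumes X: "weakly_connected_set H X" and v: "v \<in> X"
  shows "X \<subseteq> weak_class H v"
proof
  fix w assume "w \<in> X"
  then have "(v, w) \<in> rtrancl_on X ((arcs_ends (H \<restriction> X))\<^sup>s)"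
    using X v by (auto simp: weakly_connected_set_def connected_conv)
  moreover have "(arcs_ends (H \<restriction> X))\<^sup>s \<subseteq> (arcs_ends H)\<^sup>s"
    by (auto simp: arcs_ends_induce_subgraph symcl_def)
  moreover have "X \<subseteq> verts H" using X by (simp add: weakly_connected_set_def)
  ultimately show "w \<in> weak_class H v"
    unfolding weak_class_def by (blast intro: rtrancl_on_mono)
qed

text \<open>Once a vertex is present, the empty set is connected but not maximal, so only the
  classes remain.\<close>

lemma weak_components_eq_weak_classes:
  assumes "verts H \<noteq> {}"
  shows "weak_components H = weak_class H ` verts H"
proof
  have conn: "weakly_connected_set H (weak_class H v)" if "v \<in> verts H" for v
    unfolding weakly_connected_set_def using connected_weak_class[OF that] weak_class_subset[of H v] by blast
  show "weak_components H \<subseteq> weak_class H ` verts H"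
  proof
    fix X assume X: "X \<in> weak_components H"
    then have wc: "weakly_connected_set H X" by (simp add: weak_components_def)
    obtain v where v: "v \<in> verts H" "X \<subseteq> weak_class H v"
    proof (cases "X = {}")
      case True
      with assms that show ?thesis by auto
    next
      case False
      then obtain v where "v \<in> X" by auto
      with wc weakly_connected_set_subset_weak_class[OF wc] that show ?thesis
        by (auto simp: weakly_connected_set_def)
    qed
    with X conn have "weak_class H v = X" by (auto simp: weak_components_def)
    with v show "X \<in> weak_class H ` verts H" by auto
  qed
  show "weak_class H ` verts H \<subseteq> weak_components H"
  proof
    fix X assume "X \<in> weak_class H ` verts H"
    then obtain v where v: "v \<in> verts H" "X = weak_class H v" by auto
    have "Y = X" if "weakly_connected_set H Y" "X \<subseteq> Y" for Y
      using weakly_connected_set_subset_weak_class[OF that(1), of v] that(2) v weak_class_refl by fastforce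
    then show "X \<in> weak_components H" using conn v by (auto simp: weak_components_def)
  qed
qed

section \<open>Translation between digraphs and relations\<close>

lemma (in wf_digraph) acyclic_digraph_iff: "acyclic_digraph G \<longleftrightarrow> acyclic (arcs_ends G)"
proof -
  \<comment> \<open>Every nonempty closed walk yields a cycle, and closed walks are what the
    transitive closure sees.\<close>
  have "(\<exists>p. cycle p) \<longleftrightarrow> (\<exists>u p. awalk u p u \<and> p \<noteq> [])"
    using closed_w_imp_cycle unfolding cycle_def closed_w_def by blast
  then show ?thesis by (auto simp: acyclic_digraph_def acyclic_def reachable1_awalk)
qed

lemma (in wf_digraph) acyclic_induced_iff:
  "acyclic_digraph (G \<restriction> X) \<longleftrightarrow> acyclic {(a, b) \<in> arcs_ends G. a \<in> X \<and> b \<in> X}"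
  using wf_digraph.acyclic_digraph_iff[OF wellformed_induce_subgraph]
  by (simp add: arcs_ends_induce_subgraph)

lemma (in wf_digraph) dicolours_of_dicolouring:
  assumes c: "dicolouring (G \<restriction> W) m c" and "m \<le> n"
  shows "dicolours (arcs_ends G) n W c"
proof -
  \<comment> \<open>Passing to \<open>?M\<close> removes the arcs between different colours, so
    gluing along \<open>f = c\<close> applies.\<close>
  let ?M = "mono_arcs (arcs_ends G) W c"
  have "dicolours ?M n W c"
  proof (rule dicolours_by_classes[where f = c])
    fix l
    show "dicolours ?M n {x \<in> W. c x = l} c"
    proof (cases "l < m")
      case True
      have "mono_arcs ?M {x \<in> W. c x = l} c =
          {(a, b) \<in> arcs_ends (G \<restriction> W). a \<in> {x \<in> W. c x = l} \<and> b \<in> {x \<in> W. c x = l}}"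
        by (auto simp: mono_arcs_def arcs_ends_induce_subgraph)
      moreover have "acyclic \<dots>"
        using c True wf_digraph.acyclic_induced_iff[OF wellformed_induce_subgraph, of W "{x \<in> W. c x = l}"]
        by (simp add: dicolouring_def)
      ultimately show ?thesis using True assms(2) by (auto simp: dicolours_def)
    next
      case False
      then have empty: "{x \<in> W. c x = l} = {}" using c by (auto simp: dicolouring_def)
      show ?thesis unfolding empty by (simp add: dicolours_def mono_arcs_def acyclic_def)
    qed
  qed (auto simp: mono_arcs_def)
  moreover have "mono_arcs ?M W c = ?M" by (auto simp: mono_arcs_def)
  ultimately show ?thesis by (simp add: dicolours_def)
qed

lemma (in wf_digraph) dicolouring_of_dicolours:
  assumes "dicolours (arcs_ends G) n (verts G) c"
  shows "dicolouring G n c"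
  unfolding dicolouring_def
proof (intro conjI allI impI)
  show "c ` verts G \<subseteq> {..<n}" using assms by (simp add: dicolours_def)
  fix i
  have "{(a, b) \<in> arcs_ends G. a \<in> {v \<in> verts G. c v = i} \<and> b \<in> {v \<in> verts G. c v = i}}
      \<subseteq> mono_arcs (arcs_ends G) (verts G) c"
    by (auto simp: mono_arcs_def)
  then show "acyclic_digraph (G \<restriction> {v \<in> verts G. c v = i})"
    using assms acyclic_subset unfolding acyclic_induced_iff dicolours_def by blast
qed

lemma (in digraph) dicritical_not_dicolours:
  assumes "dicritical k G" "n < k"
  shows "\<not> dicolours (arcs_ends G) n (verts G) c"
proof
  assume "dicolours (arcs_ends G) n (verts G) c"
  then have "\<exists>c. dicolouring G n c" using dicolouring_of_dicolours by blast
  then have "dichromatic_number G \<le> n" unfolding dichromatic_number_def by (rule Least_le)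
  with assms show False by (simp add: dicritical_def)
qed

lemma (in digraph) dicritical_proper_subset:
  assumes "dicritical k G" "W \<subset> verts G"
  obtains c where "dicolours (arcs_ends G) (k - 1) W c"
proof -
  have ind: "induced_subgraph (G \<restriction> W) G" using assms(2) by (intro induced_induce) auto
  then interpret H: digraph "G \<restriction> W" by (rule digraphI_induced)
  have "G \<restriction> W \<noteq> G" using assms(2) by (metis induce_subgraph_verts psubset_eq)
  then have "dichromatic_number (G \<restriction> W) < k"
    using assms(1) ind by (auto simp: dicritical_def induced_imp_subgraph)
  then show ?thesis
    using H.dichromatic_number_attained dicolours_of_dicolouring[of W _ _ "k - 1"] that
    by (metis Suc_diff_1 bot_nat_0.not_eq_extremum less_Suc_eq_le not_less_zero)
qed

lemma (in digraph) total_degree_eq_vertex_degree: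
  "total_degree (arcs_ends G) (verts G) x = vertex_degree G x"
proof -
  have "{y \<in> verts G. x \<rightarrow> y} = {y. x \<rightarrow> y}" "{y \<in> verts G. y \<rightarrow> x} = {y. y \<rightarrow> x}"
    by (auto dest: adj_in_verts)
  then show ?thesis by (simp add: total_degree_def vertex_degree_neighbours)
qed

section \<open>The bound on the number of components\<close>

theorem theorem1p8:
  fixes G :: "('a, 'b) pre_digraph" and k :: nat and S :: "'a set"
  assumes "k \<ge> 3"
    and "digraph G"
    and "dicritical k G"
    and "S = {x \<in> verts G. vertex_degree G x \<le> 2 * (k - 1)}"
  shows "card (weak_components (G \<restriction> (verts G - S))) \<le> card (weak_components (G \<restriction> S))"
proof (rule ccontr)
  assume neg: "\<not> ?thesis"
  interpret digraph G by (rule assms(2))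
  let ?E = "arcs_ends G"
  define H where "H = verts G - S"
  define p where "p = weak_class (G \<restriction> H)"
  define t where "t = weak_class (G \<restriction> S)"
  have SV: "S \<subseteq> verts G" "S \<inter> H = {}" "S \<union> H = verts G" using assms(4) by (auto simp: H_def)
  have fin: "finite S" "finite H" using finite_verts SV by (metis finite_Un)+
  \<comment> \<open>If \<open>S\<close> is empty, there is no label but still one component,
    \<open>{}\<close>; hence an inequality, with positivity stated separately.\<close>
  have "card (t ` S) \<le> card (weak_components (G \<restriction> S))" "0 < card (weak_components (G \<restriction> S))"
    using weak_components_eq_weak_classes[of "G \<restriction> S"] weak_components_null[of "G \<restriction> S"] fin
    by (cases "S = {}"; simp add: t_def card_gt_0_iff)+
  with neg have big: "card (t ` S) < card (weak_components (G \<restriction> H))" "1 < card (weak_components (G \<restriction> H))"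
    by (auto simp: H_def)
  have "H \<noteq> {}"
  proof
    assume "H = {}"
    then have "weak_components (G \<restriction> H) = {{}}" by (intro weak_components_null) simp
    with big(2) show False by simp
  qed
  then have wcH: "weak_components (G \<restriction> H) = p ` H"
    using weak_components_eq_weak_classes[of "G \<restriction> H"] by (simp add: p_def)
  \<comment> \<open>There are at least two components, so each is a proper subset of the vertices
    and criticality gives it a dicolouring with \<open>k - 1\<close> colours.\<close>
  obtain C where C: "\<And>l. dicolours ?E (k - 1) {v \<in> H. p v = l} (C l)"
  proof -
    have "\<exists>c. dicolours ?E (k - 1) {v \<in> H. p v = l} c" for l
    proof -
      have "{v \<in> H. p v = l} \<noteq> verts G"
      proof
        assume "{v \<in> H. p v = l} = verts G"
        then have "p ` H \<subseteq> {l}" using SV by blast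
        then have "card (p ` H) \<le> 1" by (metis card.empty card_mono finite.emptyI finite_insert is_singletonI is_singleton_altdef)
        with big(2) wcH show False by simp
      qed
      then have "{v \<in> H. p v = l} \<subset> verts G" using SV by auto
      then show ?thesis using dicritical_proper_subset[OF assms(3)] by metis
    qed
    then show ?thesis using that by metis
  qed
  have sepH: "p a = p b" if "a \<in> H" "b \<in> H" "(a, b) \<in> ?E" for a b
    using weak_class_arc[of a "G \<restriction> H" b] that by (auto simp: p_def arcs_ends_induce_subgraph)
  have "dicolours ?E (k - 1) H (\<lambda>v. C (p v) v)"
  proof (rule dicolours_by_classes[where f = p])
    show "dicolours ?E (k - 1) {x \<in> H. p x = l} (\<lambda>v. C (p v) v)" for l
      using C[of l] dicolours_cong[of "{x \<in> H. p x = l}" "\<lambda>v. C (p v) v" "C l"] by simp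
  qed (rule sepH)
  moreover have "unsplit ?E {w \<in> S. t w = l}" for l
  proof (cases "l \<in> t ` S")
    case True
    then obtain v where v: "v \<in> S" "l = t v" by auto
    have "{w \<in> S. t w = l} = weak_class (G \<restriction> S) v"
    proof
      show "{w \<in> S. t w = l} \<subseteq> weak_class (G \<restriction> S) v"
      proof
        fix w assume "w \<in> {w \<in> S. t w = l}"
        then have "w \<in> t w" "t w = l" using weak_class_refl[of w "G \<restriction> S"] by (simp_all add: t_def)
        with v(2) show "w \<in> weak_class (G \<restriction> S) v" by (simp add: t_def)
      qed
      show "weak_class (G \<restriction> S) v \<subseteq> {w \<in> S. t w = l}"
      proof
        fix w assume w: "w \<in> weak_class (G \<restriction> S) v"
        then have "w \<in> S" using weak_class_subset[of "G \<restriction> S" v] by auto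
        with weak_class_eq[OF w] v(2) show "w \<in> {w \<in> S. t w = l}" by (simp add: t_def)
      qed
    qed
    then have "unsplit (arcs_ends (G \<restriction> S)) {w \<in> S. t w = l}" by (simp add: unsplit_weak_class)
    then show ?thesis unfolding unsplit_def adjacent_def arcs_ends_induce_subgraph by blast
  next
    case False
    then have "{w \<in> S. t w = l} = {}" by auto
    then show ?thesis by (simp only: unsplit_empty)
  qed
  moreover have "total_degree ?E (H \<union> S) u \<le> 2 * (k - 1)" if "u \<in> S" for u
    using that SV total_degree_eq_vertex_degree[of u] assms(4) by (simp add: Un_commute)
  moreover have "t a = t b" if "a \<in> S" "b \<in> S" "(a, b) \<in> ?E" for a b
    using weak_class_arc[of a "G \<restriction> S" b] that by (auto simp: t_def arcs_ends_induce_subgraph)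
  moreover have "(u, u) \<notin> ?E" for u
    using no_loops by (auto simp: arcs_ends_conv)
  ultimately interpret low_extension ?E "k - 1" H S p t "\<lambda>v. C (p v) v"
    using fin SV(2) sepH by unfold_locales auto
  let ?N = "attached ?E H S p t"
  let ?Q = "\<lambda>J. J \<subseteq> t ` S \<and> card (?N J) \<le> card J"
  have finS: "finite (t ` S)" using fin by simp
  \<comment> \<open>The empty family satisfies \<open>?Q\<close>, so a largest family satisfying it
    exists.\<close>
  have "?Q {}" by (auto simp: attached_def)
  moreover have "\<forall>J. ?Q J \<longrightarrow> card J < Suc (card (t ` S))"
    using finS by (auto simp: less_Suc_eq_le intro: card_mono)
  ultimately obtain J where J: "?Q J" and max: "\<And>J'. ?Q J' \<Longrightarrow> card J' \<le> card J"
    using ex_has_greatest_nat[of ?Q "{}" card "Suc (card (t ` S))"] by (metis (no_types, lifting))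
  define U1 where "U1 = {u \<in> S. t u \<in> J}"
  define P1 where "P1 = {v \<in> H. p v \<in> ?N J}"
  \<comment> \<open>\<open>J\<close> touches at most \<open>card J\<close> parts, fewer than there
    are components of \<open>G - S\<close>. So the set to be merged is proper and criticality
    colours it.\<close>
  have "P1 \<noteq> H"
  proof
    assume "P1 = H"
    then have "p ` H \<subseteq> ?N J" by (auto simp: P1_def)
    then have "card (p ` H) \<le> card (?N J)" using fin by (intro card_mono finite_attached)
    also have "\<dots> \<le> card (t ` S)" using J card_mono[OF finS] by (meson order_trans)
    finally show False using big(1) wcH by simp
  qed
  then have "P1 \<union> U1 \<subset> verts G" using SV by (auto simp: P1_def U1_def)
  then obtain c1 where c1: "dicolours ?E (k - 1) (P1 \<union> U1) c1"
    using dicritical_proper_subset[OF assms(3)] by metis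
  have no_empty: "{} \<notin> p ` H - ?N J"
    using weak_class_refl[of _ "G \<restriction> H"] by (force simp: p_def)
  \<comment> \<open>The empty set is no class and serves as the label of the merged part.\<close>
  let ?p = "\<lambda>v. if v \<in> P1 \<union> U1 then {} else p v"
  let ?c = "\<lambda>v. if v \<in> P1 \<union> U1 then c1 v else C (p v) v"
  have ext: "low_extension ?E (k - 1) (H \<union> U1) (S - U1) ?p t ?c"
    using absorb_labels[of J c1 "{}"] c1 no_empty unfolding P1_def U1_def by blast
  have "expanding ?E (H \<union> U1) (S - U1) ?p t"
    unfolding expanding_def
  proof (intro allI impI)
    fix J' assume J': "J' \<subseteq> t ` (S - U1)" "J' \<noteq> {}"
    let ?N' = "attached ?E (H \<union> U1) (S - U1) ?p t J'"
    have J'S: "J' \<subseteq> t ` S" using J' by auto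
    have finJ: "finite J" "finite J'" using J J'S finite_subset[OF _ finS] by blast+
    have "J \<inter> J' = {}" using J' by (auto simp: U1_def)
    then have card_Un: "card (J \<union> J') = card J + card J'" using finJ by (simp add: card_Un_disjoint)
    moreover have "0 < card J'" using J'(2) finJ by (simp add: card_gt_0_iff)
    \<comment> \<open>By maximality of \<open>J\<close>, the larger family touches more parts than
      it has members. At most \<open>card J\<close> of them are attached to \<open>J\<close>, so
      \<open>J'\<close> touches more than \<open>card J'\<close> parts that are not
      absorbed.\<close>
    ultimately have "\<not> ?Q (J \<union> J')" using max[of "J \<union> J'"] by linarith
    then have "card J + card J' < card (?N J \<union> ?N J')"
      using J J'S card_Un by (auto simp: attached_Un)
    also have "\<dots> = card (?N J) + card (?N J' - ?N J)"
      using fin card_Un_disjoint[of "?N J" "?N J' - ?N J"] by (auto simp: finite_attached)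
    finally have "card J' < card (?N J' - ?N J)" using J by linarith
    also have "\<dots> \<le> card ?N'"
    proof (rule card_mono)
      show "finite ?N'" using fin by (intro finite_attached) (auto simp: U1_def)
      show "?N J' - ?N J \<subseteq> ?N'"
        using attached_absorb_labels(1)[of J' J "{}"] J'(1) unfolding P1_def U1_def by blast
    qed
    finally show "card J' < card ?N'" .
  qed
  from dicolouring_extends[OF ext this] obtain c' where "dicolours ?E (k - 1) (H \<union> U1 \<union> (S - U1)) c'"
    by blast
  moreover have "H \<union> U1 \<union> (S - U1) = verts G" using SV by (auto simp: U1_def)
  ultimately show False
    using dicritical_not_dicolours[OF assms(3), of "k - 1"] assms(1) by auto
qed

end
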